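(* Let $F\subset X$ be a $\nu$-measurable set with $\nu(F)>0$ and let $\lambda>0$. Then there exists a minimizer $u_\lambda$ of $\mathcal E_m(\cdot,\chi_F,\lambda)$ over $L^1(X,\nu)$. Moreover, for almost every $t\in\,]0,1[$, $E_t(u_\lambda)$ is a minimizer of $\mathcal E_m^G(\cdot,F,\lambda)$, and $$\min_{A\in\mathcal B(X)}\mathcal E_m^G(A,F,\lambda)=\min_{u\in L^1(X,\nu)}\mathcal E_m(u,\chi_F,\lambda).$$
   Context: Setting: $(X,d)$ is a Polish metric space with its Borel $\sigma$-algebra $\mathcal B(X)$. A random walk $m=(m_x)_{x\in X}$ on $X$ is a family of Borel probability measures on $X$ such that $x\mapsto m_x(A)$ is Borel for every Borel $A\subset X$ and $\int_X d(z,y)\,dm_x(y)<\infty$ for all $x\in X$ and some (hence any) $z\in X$; $[X,d,m]$ is a metric random walk space. $\nu$ is a finite (nonzero) Radon measure on $X$ which is reversible for $m$: $dm_x(y)d\nu(x)=dm_y(x)d\nu(y)$ as measures on $X\times X$ (this implies invariance, $\nu(A)=\int_X m_x(A)\,d\nu(x)$). It is also assumed that $\frac1{\nu(X)}\nu$ is ergodic with respect to $m$: every Borel set $B$ with $m_x(B)=1$ for all $x\in B$ satisfies $\nu(B)=0$ or $\nu(B)=\nu(X)$. $m$-total variation: $TV_m(u)=\frac12\int_X\int_X|u(y)-u(x)|\,dm_x(y)\,d\nu(x)$. $m$-perimeter of a $\nu$-measurable $E\subset X$: $P_m(E)=\int_E\int_{X\setminus E}dm_x(y)\,d\nu(x)=TV_m(\chi_E)$.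 $\mathcal E_m(u,f,\lambda)=TV_m(u)+\lambda\int_X|u-f|\,d\nu$ for $u,f\in L^1(X,\nu)$. $\mathcal E_m^G(A,F,\lambda)=P_m(A)+\lambda\,\nu(A\bigtriangleup F)$, where $A\bigtriangleup F=(A\setminus F)\cup(F\setminus A)$; a minimizer of $\mathcal E_m^G(\cdot,F,\lambda)$ is a set at which this functional attains the value $\inf_{A\in\mathcal B(X)}\mathcal E_m^G(A,F,\lambda)$. $E_t(u)=\{x\in X:u(x)>t\}$. $\chi_F$ is the characteristic function of $F$. *)

theory Defs
  imports "HOL-Probability.Probability"
begin

definition random_walk :: "('a::polish_space \<Rightarrow> 'a measure) \<Rightarrow> bool" where
  "random_walk m \<longleftrightarrow>
     (\<forall>x. prob_space (m x) \<and> sets (m x) = sets borel) \<and>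
     (\<forall>A\<in>sets borel. (\<lambda>x. emeasure (m x) A) \<in> borel_measurable borel) \<and>
     (\<exists>z. \<forall>x. (\<integral>\<^sup>+y. ennreal (dist z y) \<partial>m x) < \<infinity>)"

definition finite_radon_measure :: "'a::polish_space measure \<Rightarrow> bool" where
  "finite_radon_measure \<nu> \<longleftrightarrow>
     sets \<nu> = sets borel \<and> finite_measure \<nu> \<and>
     (\<forall>B\<in>sets borel. emeasure \<nu> B = (SUP K\<in>{K. K \<subseteq> B \<and> compact K}. emeasure \<nu> K))"

text \<open>The measures \<open>dm_x(y) d\<nu>(x)\<close> and \<open>dm_y(x) d\<nu>(y)\<close> agree on the Borel sets of the product.\<close>

definition reversible :: "('a::polish_space \<Rightarrow> 'a measure) \<Rightarrow> 'a measure \<Rightarrow> bool" where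
  "reversible m \<nu> \<longleftrightarrow>
     (\<forall>C\<in>sets (borel :: ('a \<times> 'a) measure).
        (\<integral>\<^sup>+x. (\<integral>\<^sup>+y. indicator C (x, y) \<partial>m x) \<partial>\<nu>) =
        (\<integral>\<^sup>+y. (\<integral>\<^sup>+x. indicator C (x, y) \<partial>m y) \<partial>\<nu>))"

text \<open>Ergodicity of \<open>\<nu> / \<nu>(X)\<close>, stated without normalising \<open>\<nu>\<close>.\<close>

definition ergodic :: "('a::polish_space \<Rightarrow> 'a measure) \<Rightarrow> 'a measure \<Rightarrow> bool" where
  "ergodic m \<nu> \<longleftrightarrow>
     (\<forall>B\<in>sets borel. (\<forall>x\<in>B. emeasure (m x) B = 1) \<longrightarrow>
        emeasure \<nu> B = 0 \<or> emeasure \<nu> B = emeasure \<nu> UNIV)"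

text \<open>
  A \<open>\<nu>\<close>-measurable set or function is one that is measurable for \<open>completion \<nu>\<close>. By invariance
  of \<open>\<nu>\<close>, such an object is measurable for \<open>completion (m x)\<close> for \<open>\<nu>\<close>-almost every \<open>x\<close>, so the
  iterated integrals below are taken with respect to completed measures. All functionals take
  values in \<open>ennreal\<close>, so that no value is left unspecified by divergence of an integral.
\<close>

definition TV :: "('a::polish_space \<Rightarrow> 'a measure) \<Rightarrow> 'a measure \<Rightarrow> ('a \<Rightarrow> real) \<Rightarrow> ennreal" where
  "TV m \<nu> u =
     1 / 2 * (\<integral>\<^sup>+x. (\<integral>\<^sup>+y. ennreal \<bar>u y - u x\<bar> \<partial>completion (m x)) \<partial>completion \<nu>)"

definition perimeter :: "('a::polish_space \<Rightarrow> 'a measure) \<Rightarrow> 'a measure \<Rightarrow> 'a set \<Rightarrow> ennreal" where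
  "perimeter m \<nu> E =
     (\<integral>\<^sup>+x\<in>E. (\<integral>\<^sup>+y\<in>UNIV - E. 1 \<partial>completion (m x)) \<partial>completion \<nu>)"

text \<open>Elements of \<open>L\<^sup>1(X, \<nu>)\<close> are given by representatives.\<close>

definition L1 :: "'a::polish_space measure \<Rightarrow> ('a \<Rightarrow> real) set" where
  "L1 \<nu> = {u. integrable (completion \<nu>) u}"

definition energy ::
  "('a::polish_space \<Rightarrow> 'a measure) \<Rightarrow> 'a measure \<Rightarrow> ('a \<Rightarrow> real) \<Rightarrow> ('a \<Rightarrow> real) \<Rightarrow> real \<Rightarrow> ennreal" where
  "energy m \<nu> u f lam = TV m \<nu> u + ennreal lam * (\<integral>\<^sup>+x. ennreal \<bar>u x - f x\<bar> \<partial>completion \<nu>)"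

definition geometric_energy ::
  "('a::polish_space \<Rightarrow> 'a measure) \<Rightarrow> 'a measure \<Rightarrow> 'a set \<Rightarrow> 'a set \<Rightarrow> real \<Rightarrow> ennreal" where
  "geometric_energy m \<nu> A F lam =
     perimeter m \<nu> A + ennreal lam * emeasure (completion \<nu>) ((A - F) \<union> (F - A))"

definition energy_minimizer ::
  "('a::polish_space \<Rightarrow> 'a measure) \<Rightarrow> 'a measure \<Rightarrow> ('a \<Rightarrow> real) \<Rightarrow> real \<Rightarrow> ('a \<Rightarrow> real) \<Rightarrow> bool" where
  "energy_minimizer m \<nu> f lam u \<longleftrightarrow>
     u \<in> L1 \<nu> \<and> energy m \<nu> u f lam = (INF v\<in>L1 \<nu>. energy m \<nu> v f lam)"

text \<open>
  The infimum ranges over Borel sets, while a minimizer is only required to be \<open>\<nu>\<close>-measurable: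
  superlevel sets of an \<open>L\<^sup>1\<close> representative need not be Borel.
\<close>

definition geometric_minimizer ::
  "('a::polish_space \<Rightarrow> 'a measure) \<Rightarrow> 'a measure \<Rightarrow> 'a set \<Rightarrow> real \<Rightarrow> 'a set \<Rightarrow> bool" where
  "geometric_minimizer m \<nu> F lam A \<longleftrightarrow>
     A \<in> sets (completion \<nu>) \<and>
     geometric_energy m \<nu> A F lam = (INF B\<in>sets borel. geometric_energy m \<nu> B F lam)"

definition superlevel :: "('a \<Rightarrow> real) \<Rightarrow> real \<Rightarrow> 'a set" where
  "superlevel u t = {x. u x > t}"

end

theory Submission
  imports Defs
begin

text \<open>
  The perimeter is the total variation of an indicator function: the two ordered crossings of the
  boundary of a set have the same mass by reversibility, which absorbs the factor \<open>1/2\<close>. So the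
  geometric energy of \<open>A\<close> is the energy of \<open>\<chi>\<^sub>A\<close>, and both problems concern the single functional
  \<open>u \<mapsto> \<integral>\<integral> \<bar>u y - u x\<bar> / 2 + \<lambda> \<bar>u x - \<chi>\<^sub>F x\<bar> dm\<^sub>x(y) d\<nu>(x)\<close>.

  The infimum over Borel sets is attained by a direct construction. On indicators the
  integrand above is submodular in the set, pointwise in \<open>(x, y)\<close>, and Fatou's lemma makes the
  functional lower semicontinuous along pointwise convergent sequences of sets. If \<open>A\<^sub>n\<close> has
  energy within \<open>(1/2)^(n + 1)\<close> of the infimum, then by submodularity these excesses at most add up under
  unions, because the energy of the corresponding intersection is at least the infimum. The
  unions of \<open>A\<^sub>k\<close> over \<open>k \<ge> n\<close> then have excess at most \<open>(1/2)^n\<close>, and the limit superior of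
  the sequence is a minimizer (\<open>submodular_lsc_attains_INF\<close>, \<open>geometric_energy_attains_INF\<close>).

  Functions are compared with sets by integrating over levels. The layers at levels \<open>t \<in> ]0,1[\<close>
  of two real numbers \<open>a\<close>, \<open>b\<close> differ on a set of levels of length at most \<open>\<bar>a - b\<bar>\<close>, so
  Tonelli's theorem bounds the integral over these \<open>t\<close> of the geometric energies of the
  superlevel sets of \<open>u\<close> by the energy of \<open>u\<close>
  (\<open>geometric_energy_coarea_le\<close>). The energy of \<open>u\<close> is thus at least the geometric infimum, with
  equality for the indicator of a minimizing set. For any minimizer \<open>u\<close> the integral over the levels
  equals the infimum, so almost every superlevel set in that range is a minimizing set.

  Objects measurable only for the completion of \<open>\<nu>\<close> are replaced by Borel representatives;
  by invariance, a \<open>\<nu>\<close>-null set is \<open>m\<^sub>x\<close>-null for \<open>\<nu>\<close>-almost every \<open>x\<close>, so the iterated integrals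
  do not change.
\<close>

section \<open>Minimizing submodular set functions\<close>

text \<open>
  The sets \<open>A n\<close> below are chosen with excess \<open>(1/2)^Suc n\<close> over the infimum \<open>I\<close>, so that the
  excesses of \<open>A n, \<dots>, A (n + k)\<close> sum to \<open>(1/2)^n - (1/2)^Suc (n + k)\<close>. Submodularity passes this
  sum to their union, and the two semicontinuity hypotheses carry the bound to the unions of the
  tails and then to their intersection.
\<close>

lemma submodular_lsc_attains_INF:
  fixes G :: "'a set \<Rightarrow> ennreal"
  assumes submodular: "\<And>A B. A \<in> sets M \<Longrightarrow> B \<in> sets M \<Longrightarrow> G (A \<union> B) + G (A \<inter> B) \<le> G A + G B"
    and lsc_incseq: "\<And>A. range A \<subseteq> sets M \<Longrightarrow> incseq A \<Longrightarrow> G (\<Union>n. A n) \<le> liminf (\<lambda>n. G (A n))"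
    and lsc_decseq: "\<And>A. range A \<subseteq> sets M \<Longrightarrow> decseq A \<Longrightarrow> G (\<Inter>n. A n) \<le> liminf (\<lambda>n. G (A n))"
  shows "\<exists>A\<in>sets M. G A = (INF B\<in>sets M. G B)"
proof -
  define I where "I = (INF B\<in>sets M. G B)"
  have I_le: "I \<le> G B" if "B \<in> sets M" for B
    unfolding I_def using that by (rule INF_lower)
  show ?thesis
  proof (cases "I = \<infinity>")
    case True
    then have "G {} = I" using I_le[of "{}"] by (simp add: top_unique)
    then show ?thesis unfolding I_def by blast
  next
    case False
    have "\<exists>A\<in>sets M. G A \<le> I + ennreal ((1/2)^Suc n)" for n
    proof -
      have "I < I + ennreal ((1/2)^Suc n)"
        using False by (simp add: less_top ennreal_zero_less_divide ennreal_add_left_cancel_less)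
      then show ?thesis
        using INF_less_iff[of G "sets M" "I + ennreal ((1/2)^Suc n)"] unfolding I_def
        by (auto intro: less_imp_le)
    qed
    then obtain A where A: "\<And>n. A n \<in> sets M" "\<And>n. G (A n) \<le> I + ennreal ((1/2)^Suc n)"
      by metis
    define U where "U n k = (\<Union>i\<in>{n..n+k}. A i)" for n k
    have U_sets: "U n k \<in> sets M" for n k
      unfolding U_def using A(1) by auto
    have U_Suc: "U n (Suc k) = U n k \<union> A (Suc (n + k))" for n k
      by (simp add: U_def atLeastAtMostSuc_conv Un_commute)
    have U_bound: "G (U n k) \<le> I + ennreal ((1/2)^n - (1/2)^Suc (n + k))" for n k
    proof (induction k)
      case 0
      show ?case using A(2)[of n] by (simp add: U_def)
    next
      case (Suc k)
      let ?d = "(1/2)^n - (1/2::real)^Suc (n + k)" and ?e = "(1/2::real)^Suc (Suc (n + k))"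
      have "(1/2::real)^Suc (n + k) \<le> (1/2)^n"
        by (rule power_decreasing) auto
      then have d: "0 \<le> ?d" by simp
      \<comment> \<open>The intersection costs at least \<open>I\<close>, so adding \<open>A (Suc (n + k))\<close> raises the excess
        by no more than its own.\<close>
      have "I + G (U n (Suc k)) \<le> G (U n k \<inter> A (Suc (n + k))) + G (U n k \<union> A (Suc (n + k)))"
        unfolding U_Suc by (intro add_mono I_le order_refl sets.Int U_sets A)
      also have "\<dots> \<le> G (U n k) + G (A (Suc (n + k)))"
        using submodular[OF U_sets A(1), of n k "Suc (n + k)"] by (simp only: add.commute)
      also have "\<dots> \<le> (I + ennreal ?d) + (I + ennreal ?e)"
        by (intro add_mono Suc A(2))
      also have "\<dots> = I + (I + ennreal (?d + ?e))"
        using d by (subst ennreal_plus) (auto simp: ac_simps)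
      finally have "G (U n (Suc k)) \<le> I + ennreal (?d + ?e)"
        using False by (simp add: ennreal_add_left_cancel_le)
      also have "?d + ?e = (1/2)^n - (1/2)^Suc (n + Suc k)"
        by (simp add: field_simps)
      finally show ?case .
    qed
    define B where "B n = (\<Union>k. U n k)" for n
    have B_sets: "B n \<in> sets M" for n
      unfolding B_def using U_sets by auto
    have B_bound: "G (B n) \<le> I + ennreal ((1/2)^n)" for n
    proof -
      have "G (B n) \<le> liminf (\<lambda>k. G (U n k))"
        unfolding B_def
        by (rule lsc_incseq) (use U_sets in \<open>auto simp: incseq_Suc_iff U_Suc\<close>)
      also have "\<dots> \<le> liminf (\<lambda>k::nat. I + ennreal ((1/2)^n))"
        by (intro Liminf_mono always_eventually allI order_trans[OF U_bound] add_left_mono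
              ennreal_leI) simp
      finally show ?thesis by (simp add: Liminf_const)
    qed
    have "decseq B"
    proof (rule decseq_SucI)
      fix n
      have "U (Suc n) k \<subseteq> U n (Suc k)" for k
        unfolding U_def by (intro UN_mono) auto
      then show "B (Suc n) \<subseteq> B n"
        unfolding B_def by blast
    qed
    then have "G (\<Inter>n. B n) \<le> liminf (\<lambda>n. G (B n))"
      using B_sets by (intro lsc_decseq) auto
    also have "\<dots> \<le> liminf (\<lambda>n. I + ennreal ((1/2)^n))"
      by (intro Liminf_mono always_eventually allI B_bound)
    also have "(\<lambda>n. I + ennreal ((1/2)^n)) \<longlonglongrightarrow> I + ennreal 0"
      by (intro tendsto_intros LIMSEQ_power_zero) auto
    then have "liminf (\<lambda>n. I + ennreal ((1/2)^n)) = I"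
      by (simp add: lim_imp_Liminf)
    finally have "G (\<Inter>n. B n) = I"
      using I_le[of "\<Inter>n. B n"] B_sets by (intro antisym) auto
    then show ?thesis
      unfolding I_def using B_sets by (intro bexI[of _ "\<Inter>n. B n"]) auto
  qed
qed

section \<open>The energy density and its layers\<close>

text \<open>
  The layer-cake formula would be an equality for the integral over all real levels; restricting
  to \<open>]0,1[\<close> keeps the levels at which \<open>{x. \<chi>\<^sub>F x > t} = F\<close>.
\<close>

lemma layer_cake_le:
  fixes a b :: real
  shows "(\<integral>\<^sup>+t\<in>{0<..<1}. ennreal \<bar>indicat_real {t<..} a - indicat_real {t<..} b\<bar> \<partial>lborel)
    \<le> ennreal \<bar>a - b\<bar>"
proof -
  have "(\<integral>\<^sup>+t\<in>{0<..<1}. ennreal \<bar>indicat_real {t<..} a - indicat_real {t<..} b\<bar> \<partial>lborel)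
    \<le> (\<integral>\<^sup>+t. indicator {min a b..max a b} t \<partial>lborel)"
    by (intro nn_integral_mono) (auto simp: indicator_def)
  also have "\<dots> = ennreal \<bar>a - b\<bar>"
    by (auto simp: min_def max_def)
  finally show ?thesis .
qed

lemma nn_integral_unit_interval_const:
  "(\<integral>\<^sup>+t\<in>{0<..<1::real}. c \<partial>lborel) = c"
  by (simp add: nn_integral_cmult_indicator)

definition energy_density ::
  "real \<Rightarrow> ('a \<Rightarrow> real) \<Rightarrow> ('a \<Rightarrow> real) \<Rightarrow> 'a \<Rightarrow> 'a \<Rightarrow> ennreal" where
  "energy_density lam f u x y = ennreal (\<bar>u y - u x\<bar> / 2 + lam * \<bar>u x - f x\<bar>)"

lemma energy_density_submodular:
  assumes "0 \<le> lam"
  shows "energy_density lam (indicat_real F) (indicat_real (A \<union> B)) x y +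
      energy_density lam (indicat_real F) (indicat_real (A \<inter> B)) x y
    \<le> energy_density lam (indicat_real F) (indicat_real A) x y +
      energy_density lam (indicat_real F) (indicat_real B) x y"
  using assms unfolding energy_density_def
  by (subst (1 2) ennreal_plus[symmetric]) (auto simp: indicator_def intro!: ennreal_leI)

text \<open>
  For \<open>0 < t < 1\<close> the indicator of \<open>F\<close> is the \<open>t\<close>-layer of itself, so both the jump term and the
  fidelity term are layer differences of two real numbers.
\<close>

lemma energy_density_layer_cake_le:
  assumes "0 \<le> lam"
  shows "(\<integral>\<^sup>+t\<in>{0<..<1}. energy_density lam (indicat_real F) (indicat_real (superlevel u t)) x y \<partial>lborel)
    \<le> energy_density lam (indicat_real F) u x y"
proof -
  let ?s = "\<lambda>t a. indicat_real {t<..} (a::real)"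
  have meas [measurable]: "(\<lambda>t. ?s t a) \<in> borel_measurable borel" for a
    unfolding indicator_def greaterThan_iff by measurable
  have "(\<integral>\<^sup>+t\<in>{0<..<1}. energy_density lam (indicat_real F) (indicat_real (superlevel u t)) x y \<partial>lborel) =
      (\<integral>\<^sup>+t. ennreal (1 / 2) * (ennreal \<bar>?s t (u y) - ?s t (u x)\<bar> * indicator {0<..<1} t) +
        ennreal lam * (ennreal \<bar>?s t (u x) - ?s t (indicat_real F x)\<bar> * indicator {0<..<1} t) \<partial>lborel)"
    using assms ennreal_plus[of "1 / 2" lam]
    by (intro nn_integral_cong)
      (auto simp: energy_density_def superlevel_def indicator_def ennreal_plus[symmetric]
        simp del: ennreal_plus)
  also have "\<dots> =
      ennreal (1 / 2) * (\<integral>\<^sup>+t\<in>{0<..<1}. ennreal \<bar>?s t (u y) - ?s t (u x)\<bar> \<partial>lborel) +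
      ennreal lam * (\<integral>\<^sup>+t\<in>{0<..<1}. ennreal \<bar>?s t (u x) - ?s t (indicat_real F x)\<bar> \<partial>lborel)"
    by (simp add: nn_integral_add nn_integral_cmult)
  also have "\<dots> \<le> ennreal (1 / 2) * ennreal \<bar>u y - u x\<bar> + ennreal lam * ennreal \<bar>u x - indicat_real F x\<bar>"
    by (intro add_mono mult_left_mono layer_cake_le) auto
  also have "\<dots> = energy_density lam (indicat_real F) u x y"
    unfolding energy_density_def using assms
    by (subst (1 2) ennreal_mult[symmetric], simp_all del: ennreal_plus add: ennreal_plus[symmetric])
  finally show ?thesis .
qed

section \<open>Integration over the edges of a reversible random walk\<close>

locale reversible_walk =
  fixes m :: "'a::polish_space \<Rightarrow> 'a measure" and \<nu> :: "'a measure"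
  assumes walk: "random_walk m"
    and sets_\<nu> [measurable_cong]: "sets \<nu> = sets borel"
    and finite_\<nu>: "finite_measure \<nu>"
    and reversible: "reversible m \<nu>"
begin

sublocale finite_measure \<nu> by (rule finite_\<nu>)

lemma space_\<nu> [simp]: "space \<nu> = UNIV"
  using sets_eq_imp_space_eq[OF sets_\<nu>] by simp

lemma prob_space_m: "prob_space (m x)" and sets_m [measurable_cong]: "sets (m x) = sets borel"
  using walk by (auto simp: random_walk_def)

lemma space_m [simp]: "space (m x) = UNIV"
  using sets_eq_imp_space_eq[OF sets_m] by simp

lemma kernel_measurable [measurable]: "m \<in> borel \<rightarrow>\<^sub>M subprob_algebra borel"
  using walk by (intro measurable_subprob_algebra)
    (auto simp: random_walk_def intro: prob_space_imp_subprob_space)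

lemma inner_integral_measurable [measurable (raw)]:
  assumes [measurable]: "(\<lambda>(z, y). h z y) \<in> borel_measurable (N \<Otimes>\<^sub>M borel)" "g \<in> N \<rightarrow>\<^sub>M borel"
  shows "(\<lambda>z. \<integral>\<^sup>+y. h z y \<partial>m (g z)) \<in> borel_measurable N"
  by (rule nn_integral_measurable_subprob_algebra2[where N=borel]) measurable

definition edge_integral :: "('a \<Rightarrow> 'a \<Rightarrow> ennreal) \<Rightarrow> ennreal" where
  "edge_integral h = (\<integral>\<^sup>+x. (\<integral>\<^sup>+y. h x y \<partial>m x) \<partial>\<nu>)"

lemma edge_integral_mono: "(\<And>x y. h x y \<le> k x y) \<Longrightarrow> edge_integral h \<le> edge_integral k"
  unfolding edge_integral_def by (intro nn_integral_mono)

lemma edge_integral_add: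
  assumes [measurable]: "(\<lambda>(x, y). h x y) \<in> borel_measurable (borel \<Otimes>\<^sub>M borel)"
    "(\<lambda>(x, y). k x y) \<in> borel_measurable (borel \<Otimes>\<^sub>M borel)"
  shows "edge_integral (\<lambda>x y. h x y + k x y) = edge_integral h + edge_integral k"
  unfolding edge_integral_def by (simp add: nn_integral_add)

lemma edge_integral_cmult:
  assumes [measurable]: "(\<lambda>(x, y). h x y) \<in> borel_measurable (borel \<Otimes>\<^sub>M borel)"
  shows "edge_integral (\<lambda>x y. c * h x y) = c * edge_integral h"
  unfolding edge_integral_def by (simp add: nn_integral_cmult)

lemma edge_integral_liminf:
  assumes [measurable]: "\<And>n. (\<lambda>(x, y). h n x y) \<in> borel_measurable (borel \<Otimes>\<^sub>M borel)"
  shows "edge_integral (\<lambda>x y. liminf (\<lambda>n. h n x y)) \<le> liminf (\<lambda>n. edge_integral (h n))"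
proof -
  have "edge_integral (\<lambda>x y. liminf (\<lambda>n. h n x y))
      \<le> (\<integral>\<^sup>+x. liminf (\<lambda>n. \<integral>\<^sup>+y. h n x y \<partial>m x) \<partial>\<nu>)"
    unfolding edge_integral_def by (intro nn_integral_mono nn_integral_liminf) measurable
  also have "\<dots> \<le> liminf (\<lambda>n. edge_integral (h n))"
    unfolding edge_integral_def by (intro nn_integral_liminf) measurable
  finally show ?thesis .
qed

lemma edge_integral_fst:
  "edge_integral (\<lambda>x y. h x) = (\<integral>\<^sup>+x. h x \<partial>\<nu>)"
  unfolding edge_integral_def
  by (simp add: prob_space.emeasure_space_1[OF prob_space_m, simplified])

lemma edge_integral_swap_rectangle:
  assumes [measurable]: "A \<in> sets borel" "B \<in> sets borel"
  shows "edge_integral (\<lambda>x y. indicator A x * indicator B y) =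
    edge_integral (\<lambda>x y. indicator B x * indicator A y)"
proof -
  have "A \<times> B \<in> sets (borel :: ('a \<times> 'a) measure)"
    unfolding borel_prod[symmetric] by measurable
  then have "edge_integral (\<lambda>x y. indicator (A \<times> B) (x, y)) =
      edge_integral (\<lambda>x y. indicator (A \<times> B) (y, x))"
    using reversible unfolding reversible_def edge_integral_def by blast
  then show ?thesis
    by (simp add: indicator_times mult.commute)
qed

text \<open>
  Exchanging the ends of the edges that enter a null set \<open>N\<close> gives
  \<open>\<integral> m\<^sub>x(N) d\<nu>(x) = \<nu>(N) = 0\<close>, which is the invariance of \<open>\<nu>\<close> on null sets.
\<close>

lemma AE_kernel:
  assumes "AE z in \<nu>. P z"
  shows "AE x in \<nu>. AE y in m x. P y"
proof -
  obtain N where N: "N \<in> null_sets \<nu>" "{z. \<not> P z} \<subseteq> N"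
    using assms by (auto simp: eventually_ae_filter)
  have [measurable]: "N \<in> sets borel" using N(1) sets_\<nu> by auto
  have "(\<integral>\<^sup>+x. emeasure (m x) N \<partial>\<nu>) = edge_integral (\<lambda>x y. indicator UNIV x * indicator N y)"
    unfolding edge_integral_def by (simp add: sets_m)
  also have "\<dots> = edge_integral (\<lambda>x y. indicator N x)"
    by (subst edge_integral_swap_rectangle) auto
  also have "\<dots> = 0"
    using N(1) by (simp add: edge_integral_fst null_setsD1 sets_\<nu>)
  finally have "(\<integral>\<^sup>+x. emeasure (m x) N \<partial>\<nu>) = 0" .
  moreover have "(\<lambda>x. emeasure (m x) N) \<in> borel_measurable \<nu>"
    by measurable
  ultimately have "AE x in \<nu>. emeasure (m x) N = 0"
    by (simp add: nn_integral_0_iff_AE)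
  then show ?thesis
    by eventually_elim (rule AE_I[of _ _ N], use N(2) in \<open>auto simp: sets_m\<close>)
qed

text \<open>
  For almost every \<open>x\<close> the functions \<open>u\<close> and \<open>v\<close> agree both at \<open>x\<close> and almost everywhere for
  \<open>m x\<close>. The abstract \<open>H\<close> covers the jumps of real functions and the crossings of the boundary
  of a set alike.
\<close>

lemma iterated_completion_integral_eq:
  fixes u v :: "'a \<Rightarrow> 'b"
  assumes "AE z in \<nu>. u z = v z"
  shows "(\<integral>\<^sup>+x. (\<integral>\<^sup>+y. H (u x) (u y) \<partial>completion (m x)) \<partial>completion \<nu>) =
    edge_integral (\<lambda>x y. H (v x) (v y))"
  unfolding edge_integral_def nn_integral_completion
proof (rule nn_integral_cong_AE)
  show "AE x in \<nu>. (\<integral>\<^sup>+y. H (u x) (u y) \<partial>m x) = (\<integral>\<^sup>+y. H (v x) (v y) \<partial>m x)"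
    using assms AE_kernel[OF assms]
  proof eventually_elim
    case (elim x)
    show ?case
      by (rule nn_integral_cong_AE) (use elim in \<open>auto elim: eventually_mono\<close>)
  qed
qed

section \<open>Energy and geometric energy as edge integrals\<close>

text \<open>
  The fidelity term depends on \<open>x\<close> alone and each \<open>m x\<close> has mass one, so it may be integrated
  over the edges together with the jump term.
\<close>

lemma energy_eq_edge_integral:
  assumes lam: "0 \<le> lam" and u: "AE x in \<nu>. u x = v x" and f: "AE x in \<nu>. f x = g x"
    and [measurable]: "v \<in> borel_measurable borel" "g \<in> borel_measurable borel"
  shows "energy m \<nu> u f lam = edge_integral (energy_density lam g v)"
proof -
  have "TV m \<nu> u = 1 / 2 * edge_integral (\<lambda>x y. ennreal \<bar>v y - v x\<bar>)"
    unfolding TV_def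
    by (subst iterated_completion_integral_eq[OF u, where H="\<lambda>a b. ennreal \<bar>b - a\<bar>"]) simp
  also have "\<dots> = edge_integral (\<lambda>x y. 1 / 2 * ennreal \<bar>v y - v x\<bar>)"
    by (subst edge_integral_cmult) auto
  also have "\<dots> = edge_integral (\<lambda>x y. ennreal (\<bar>v y - v x\<bar> / 2))"
    by (simp add: divide_ennreal[symmetric] ennreal_times_divide[symmetric] ennreal_divide_numeral divide_ennreal_def mult.commute)
  finally have TV: "TV m \<nu> u = edge_integral (\<lambda>x y. ennreal (\<bar>v y - v x\<bar> / 2))" .
  have "(\<integral>\<^sup>+x. ennreal \<bar>u x - f x\<bar> \<partial>completion \<nu>) = (\<integral>\<^sup>+x. ennreal \<bar>v x - g x\<bar> \<partial>\<nu>)"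
    unfolding nn_integral_completion using u f by (intro nn_integral_cong_AE) auto
  then have "ennreal lam * (\<integral>\<^sup>+x. ennreal \<bar>u x - f x\<bar> \<partial>completion \<nu>) =
      edge_integral (\<lambda>x y. ennreal (lam * \<bar>v x - g x\<bar>))"
    using lam by (simp add: edge_integral_fst ennreal_mult nn_integral_cmult)
  then show ?thesis
    unfolding energy_def TV energy_density_def using lam
    by (simp add: edge_integral_add[symmetric])
qed

text \<open>
  The jumps of the indicator of \<open>E\<close> are the crossings out of \<open>E\<close> and the crossings into \<open>E\<close>, and
  reversibility gives both the same mass.
\<close>

lemma perimeter_eq_TV:
  assumes E: "E \<in> sets (completion \<nu>)"
  shows "perimeter m \<nu> E = TV m \<nu> (indicat_real E)"
proof -
  define E' where "E' = main_part \<nu> E"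
  have [measurable]: "E' \<in> sets borel"
    unfolding E'_def using main_part_sets[OF E] sets_\<nu> by auto
  have ae: "AE x in \<nu>. (x \<in> E) = (x \<in> E')"
    using AE_in_main_part[OF E] by (auto simp: E'_def)
  let ?I = "\<lambda>A B. edge_integral (\<lambda>x y. indicator A x * indicator B y)"
  have "perimeter m \<nu> E =
      (\<integral>\<^sup>+x. (\<integral>\<^sup>+y. of_bool ((x \<in> E) \<and> \<not> (y \<in> E)) \<partial>completion (m x)) \<partial>completion \<nu>)"
    unfolding perimeter_def
    by (intro nn_integral_cong)
      (auto simp: indicator_def of_bool_def intro!: nn_integral_cong)
  also have "\<dots> = edge_integral (\<lambda>x y. of_bool ((x \<in> E') \<and> \<not> (y \<in> E')))"
    by (rule iterated_completion_integral_eq[OF ae, where H="\<lambda>a b. of_bool (a \<and> \<not> b)"])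
  also have "(\<lambda>x y. of_bool ((x \<in> E') \<and> \<not> (y \<in> E'))) =
      (\<lambda>x y. indicator E' x * indicator (- E') y :: ennreal)"
    by (auto simp: fun_eq_iff indicator_def)
  finally have P: "perimeter m \<nu> E = ?I E' (- E')" .
  have "TV m \<nu> (indicat_real E) =
      1 / 2 * edge_integral (\<lambda>x y. ennreal \<bar>indicat_real E' y - indicat_real E' x\<bar>)"
    unfolding TV_def using ae
    by (subst iterated_completion_integral_eq[where H="\<lambda>a b. ennreal \<bar>b - a\<bar>"
          and v="indicat_real E'"]) (auto simp: indicator_def)
  also have "edge_integral (\<lambda>x y. ennreal \<bar>indicat_real E' y - indicat_real E' x\<bar>) =
      edge_integral (\<lambda>x y. indicator E' x * indicator (- E') y + indicator (- E') x * indicator E' y)"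
    by (intro arg_cong[where f=edge_integral]) (auto simp: fun_eq_iff indicator_def)
  also have "\<dots> = ?I E' (- E') + ?I (- E') E'"
    by (intro edge_integral_add) measurable
  also have "?I (- E') E' = ?I E' (- E')"
    by (intro edge_integral_swap_rectangle) auto
  also have "1 / 2 * (?I E' (- E') + ?I E' (- E')) = ?I E' (- E')"
    using ennreal_divide_self[of 2]
    by (simp add: mult_2[symmetric] mult.assoc[symmetric] divide_ennreal_def mult.commute)
  finally show ?thesis using P by simp
qed

lemma geometric_energy_eq_energy:
  assumes A: "A \<in> sets (completion \<nu>)" and F: "F \<in> sets (completion \<nu>)"
  shows "geometric_energy m \<nu> A F lam = energy m \<nu> (indicat_real A) (indicat_real F) lam"
proof -
  have "emeasure (completion \<nu>) ((A - F) \<union> (F - A)) =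
      (\<integral>\<^sup>+x. indicator ((A - F) \<union> (F - A)) x \<partial>completion \<nu>)"
    using A F by (intro nn_integral_indicator[symmetric]) auto
  also have "\<dots> = (\<integral>\<^sup>+x. ennreal \<bar>indicat_real A x - indicat_real F x\<bar> \<partial>completion \<nu>)"
    by (intro nn_integral_cong) (auto simp: indicator_def)
  finally show ?thesis
    unfolding geometric_energy_def energy_def perimeter_eq_TV[OF A] by simp
qed

lemma energy_density_measurable [measurable (raw)]:
  assumes [measurable]: "u \<in> borel_measurable borel" "f \<in> borel_measurable borel"
  shows "(\<lambda>(x, y). energy_density lam f u x y) \<in> borel_measurable (borel \<Otimes>\<^sub>M borel)"
  unfolding energy_density_def by measurable

section \<open>Integration over the levels\<close>

text \<open>
  Tonelli's theorem is applied twice, to the levels against \<open>\<nu>\<close> and against each \<open>m x\<close>, to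
  move the integral over the levels inside, where the pointwise estimate applies.
\<close>

lemma edge_integral_superlevel_le:
  fixes u :: "'a \<Rightarrow> real"
  assumes lam: "0 \<le> lam" and [measurable]: "u \<in> borel_measurable borel" "F \<in> sets borel"
  defines "J \<equiv> \<lambda>t. edge_integral (energy_density lam (indicat_real F) (indicat_real (superlevel u t)))"
  shows "J \<in> borel_measurable borel"
    and "(\<integral>\<^sup>+t\<in>{0<..<1}. J t \<partial>lborel) \<le> edge_integral (energy_density lam (indicat_real F) u)"
proof -
  interpret pair: pair_sigma_finite \<nu> lborel
    by (intro pair_sigma_finite.intro sigma_finite_measure_axioms sigma_finite_lborel)
  define h where "h t x y =
    energy_density lam (indicat_real F) (indicat_real (superlevel u t)) x y" for t x y
  have J: "J t = (\<integral>\<^sup>+x. (\<integral>\<^sup>+y. h t x y \<partial>m x) \<partial>\<nu>)" for t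
    by (simp add: J_def edge_integral_def h_def)
  \<comment> \<open>Written through comparisons of \<open>t\<close> with values of \<open>u\<close>, the density is visibly jointly
    measurable in \<open>(t, x, y)\<close>.\<close>
  have h_alt: "h t x y = ennreal (\<bar>(if t < u y then 1 else 0) - (if t < u x then 1 else 0)\<bar> / 2 +
      lam * \<bar>(if t < u x then 1 else 0) - indicat_real F x\<bar>)" for t x y
    by (simp add: h_def energy_density_def superlevel_def indicator_def)
  have h_measurable [measurable (raw)]: "(\<lambda>z. h (a z) (b z) (c z)) \<in> borel_measurable N"
    if [measurable]: "a \<in> N \<rightarrow>\<^sub>M borel" "b \<in> N \<rightarrow>\<^sub>M borel" "c \<in> N \<rightarrow>\<^sub>M borel"
    for a b c and N :: "'c measure"
    unfolding h_alt by measurable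
  have inner_measurable: "(\<lambda>z. \<integral>\<^sup>+y. h (a z) (b z) y \<partial>m (b z)) \<in> borel_measurable N"
    if [measurable]: "a \<in> N \<rightarrow>\<^sub>M borel" "b \<in> N \<rightarrow>\<^sub>M borel"
    for a b and N :: "'c measure"
    by (rule inner_integral_measurable) measurable
  show "J \<in> borel_measurable borel"
    unfolding J
  proof (rule borel_measurable_nn_integral)
    show "(\<lambda>(t, x). \<integral>\<^sup>+y. h t x y \<partial>m x) \<in> borel_measurable (borel \<Otimes>\<^sub>M \<nu>)"
      unfolding split_beta' by (rule inner_measurable) measurable
  qed
  have "(\<integral>\<^sup>+t\<in>{0<..<1}. J t \<partial>lborel) =
      (\<integral>\<^sup>+t. (\<integral>\<^sup>+x. (\<integral>\<^sup>+y. h t x y \<partial>m x) * indicator {0<..<1} t \<partial>\<nu>) \<partial>lborel)"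
    unfolding J
    by (intro nn_integral_cong nn_integral_multc[symmetric] inner_measurable) measurable
  also have "\<dots> = (\<integral>\<^sup>+x. (\<integral>\<^sup>+t. (\<integral>\<^sup>+y. h t x y \<partial>m x) * indicator {0<..<1} t \<partial>lborel) \<partial>\<nu>)"
    by (rule pair.Fubini', unfold split_beta', intro borel_measurable_times_ennreal inner_measurable)
      measurable
  also have "\<dots> = edge_integral (\<lambda>x y. \<integral>\<^sup>+t\<in>{0<..<1}. h t x y \<partial>lborel)"
    unfolding edge_integral_def
  proof (rule nn_integral_cong)
    fix x
    interpret mx: prob_space "m x" by (rule prob_space_m)
    interpret mx: pair_sigma_finite "m x" lborel
      by (intro pair_sigma_finite.intro mx.sigma_finite_measure_axioms sigma_finite_lborel)
    have "(\<integral>\<^sup>+t. (\<integral>\<^sup>+y. h t x y \<partial>m x) * indicator {0<..<1} t \<partial>lborel) =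
        (\<integral>\<^sup>+t. (\<integral>\<^sup>+y. h t x y * indicator {0<..<1} t \<partial>m x) \<partial>lborel)"
      by (intro nn_integral_cong nn_integral_multc[symmetric]) measurable
    also have "\<dots> = (\<integral>\<^sup>+y. (\<integral>\<^sup>+t. h t x y * indicator {0<..<1} t \<partial>lborel) \<partial>m x)"
      by (rule mx.Fubini') measurable
    finally show "(\<integral>\<^sup>+t. (\<integral>\<^sup>+y. h t x y \<partial>m x) * indicator {0<..<1} t \<partial>lborel) =
        (\<integral>\<^sup>+y. (\<integral>\<^sup>+t. h t x y * indicator {0<..<1} t \<partial>lborel) \<partial>m x)" .
  qed
  also have "\<dots> \<le> edge_integral (energy_density lam (indicat_real F) u)"
    unfolding h_def using lam by (intro edge_integral_mono energy_density_layer_cake_le)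
  finally show "(\<integral>\<^sup>+t\<in>{0<..<1}. J t \<partial>lborel) \<le> edge_integral (energy_density lam (indicat_real F) u)" .
qed

lemma borel_representative:
  assumes "A \<in> sets (completion \<nu>)"
  obtains B where "B \<in> sets borel" "AE x in \<nu>. indicat_real A x = indicat_real B x"
proof
  show "main_part \<nu> A \<in> sets borel"
    using main_part_sets[OF assms] sets_\<nu> by simp
  show "AE x in \<nu>. indicat_real A x = indicat_real (main_part \<nu> A) x"
    using AE_in_main_part[OF assms] by (auto simp: indicator_def)
qed

lemma sets_completion_borel: "A \<in> sets borel \<Longrightarrow> A \<in> sets (completion \<nu>)"
  by (simp add: sets_\<nu> sets_completionI_sets)

text \<open>
  The geometric energy of the superlevel sets, integrated over the levels in \<open>]0,1[\<close>, is at most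
  the energy of \<open>u\<close>. The superlevel sets of \<open>u\<close> are only measurable for the completion, so the
  comparison with the infimum over Borel sets passes through a Borel representative of \<open>u\<close>.
\<close>

lemma geometric_energy_superlevel:
  assumes lam: "0 \<le> lam" and F: "F \<in> sets (completion \<nu>)" and u: "u \<in> L1 \<nu>"
  shows superlevel_sets_completion: "superlevel u t \<in> sets (completion \<nu>)"
    and geometric_energy_superlevel_measurable:
      "(\<lambda>t. geometric_energy m \<nu> (superlevel u t) F lam) \<in> borel_measurable lborel"
    and INF_le_geometric_energy_superlevel:
      "(INF B\<in>sets borel. geometric_energy m \<nu> B F lam) \<le> geometric_energy m \<nu> (superlevel u t) F lam"
    and geometric_energy_coarea_le:
      "(\<integral>\<^sup>+t\<in>{0<..<1}. geometric_energy m \<nu> (superlevel u t) F lam \<partial>lborel)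
        \<le> energy m \<nu> u (indicat_real F) lam"
proof -
  obtain F' where F' [measurable]: "F' \<in> sets borel"
    and F_eq: "AE x in \<nu>. indicat_real F x = indicat_real F' x"
    using borel_representative[OF F] .
  have u_meas [measurable]: "u \<in> borel_measurable (completion \<nu>)"
    using u by (auto simp: L1_def)
  then obtain v where "v \<in> borel_measurable \<nu>" and u_eq: "AE x in \<nu>. u x = v x"
    using completion_ex_borel_measurable_real by blast
  then have [measurable]: "v \<in> borel_measurable borel"
    by (simp cong: measurable_cong_sets add: sets_\<nu>)
  define J where
    "J t = edge_integral (energy_density lam (indicat_real F') (indicat_real (superlevel v t)))" for t
  have sup_v [measurable]: "superlevel v t \<in> sets borel" for t
    unfolding superlevel_def by measurable
  have sup_u: "superlevel u t \<in> sets (completion \<nu>)" for t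
  proof -
    have "{x \<in> space (completion \<nu>). t < u x} \<in> sets (completion \<nu>)" by measurable
    then show ?thesis by (simp add: superlevel_def)
  qed
  have J_v: "J t = geometric_energy m \<nu> (superlevel v t) F lam" for t
    unfolding geometric_energy_eq_energy[OF sets_completion_borel[OF sup_v] F] J_def
    by (rule energy_eq_edge_integral[OF lam _ F_eq, symmetric]) auto
  have J_u: "geometric_energy m \<nu> (superlevel u t) F lam = J t" for t
    unfolding geometric_energy_eq_energy[OF sup_u F] J_def
  proof (rule energy_eq_edge_integral[OF lam _ F_eq])
    show "AE x in \<nu>. indicat_real (superlevel u t) x = indicat_real (superlevel v t) x"
      using u_eq by eventually_elim (simp add: superlevel_def indicator_def)
  qed measurable
  show "superlevel u t \<in> sets (completion \<nu>)" by (rule sup_u)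
  show "(\<lambda>t. geometric_energy m \<nu> (superlevel u t) F lam) \<in> borel_measurable lborel"
    using edge_integral_superlevel_le(1)[OF lam, of v F'] by (simp add: J_u J_def)
  show "(INF B\<in>sets borel. geometric_energy m \<nu> B F lam) \<le> geometric_energy m \<nu> (superlevel u t) F lam"
    unfolding J_u J_v by (rule INF_lower) (rule sup_v)
  have "energy m \<nu> u (indicat_real F) lam =
      edge_integral (energy_density lam (indicat_real F') v)"
    by (rule energy_eq_edge_integral[OF lam u_eq F_eq]) auto
  then show "(\<integral>\<^sup>+t\<in>{0<..<1}. geometric_energy m \<nu> (superlevel u t) F lam \<partial>lborel)
      \<le> energy m \<nu> u (indicat_real F) lam"
    using edge_integral_superlevel_le(2)[OF lam, of v F'] by (simp add: J_u J_def)
qed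

section \<open>Minimizers\<close>

text \<open>
  Lower semicontinuity holds along every pointwise convergent sequence of indicators: the densities
  then converge pointwise, and Fatou's lemma applies.
\<close>

lemma geometric_energy_attains_INF:
  assumes lam: "0 \<le> lam" and F: "F \<in> sets (completion \<nu>)"
  shows "\<exists>A\<in>sets borel.
    geometric_energy m \<nu> A F lam = (INF B\<in>sets borel. geometric_energy m \<nu> B F lam)"
proof -
  obtain F' where F' [measurable]: "F' \<in> sets borel"
    and F_eq: "AE x in \<nu>. indicat_real F x = indicat_real F' x"
    using borel_representative[OF F] .
  let ?d = "\<lambda>A. energy_density lam (indicat_real F') (indicat_real A)"
  have eq: "geometric_energy m \<nu> A F lam = edge_integral (?d A)" if [measurable]: "A \<in> sets borel" for A
    unfolding geometric_energy_eq_energy[OF sets_completion_borel[OF that] F]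
    by (rule energy_eq_edge_integral[OF lam _ F_eq]) auto
  have lsc: "geometric_energy m \<nu> B F lam \<le> liminf (\<lambda>n. geometric_energy m \<nu> (A n) F lam)"
    if A: "\<And>n. A n \<in> sets borel" and [measurable]: "B \<in> sets borel"
      and lim: "\<And>x. (\<lambda>n. indicat_real (A n) x) \<longlonglongrightarrow> indicat_real B x" for A B
  proof -
    note A [measurable]
    have "liminf (\<lambda>n. ?d (A n) x y) = ?d B x y" for x y
      unfolding energy_density_def
      by (intro lim_imp_Liminf tendsto_intros lim) auto
    then have "geometric_energy m \<nu> B F lam = edge_integral (\<lambda>x y. liminf (\<lambda>n. ?d (A n) x y))"
      by (simp add: eq)
    also have "\<dots> \<le> liminf (\<lambda>n. edge_integral (?d (A n)))"
      by (intro edge_integral_liminf) measurable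
    finally show ?thesis by (simp add: eq A)
  qed
  show ?thesis
  proof (rule submodular_lsc_attains_INF)
    fix A B :: "'a set" assume [measurable]: "A \<in> sets borel" "B \<in> sets borel"
    have "edge_integral (\<lambda>x y. ?d (A \<union> B) x y + ?d (A \<inter> B) x y)
        \<le> edge_integral (\<lambda>x y. ?d A x y + ?d B x y)"
      by (intro edge_integral_mono energy_density_submodular lam)
    then show "geometric_energy m \<nu> (A \<union> B) F lam + geometric_energy m \<nu> (A \<inter> B) F lam
        \<le> geometric_energy m \<nu> A F lam + geometric_energy m \<nu> B F lam"
      by (simp add: eq edge_integral_add)
  next
    fix A :: "nat \<Rightarrow> 'a set" assume "range A \<subseteq> sets borel" "incseq A"
    then show "geometric_energy m \<nu> (\<Union>n. A n) F lam \<le> liminf (\<lambda>n. geometric_energy m \<nu> (A n) F lam)"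
      by (intro lsc LIMSEQ_indicator_incseq) auto
  next
    fix A :: "nat \<Rightarrow> 'a set" assume "range A \<subseteq> sets borel" "decseq A"
    then show "geometric_energy m \<nu> (\<Inter>n. A n) F lam \<le> liminf (\<lambda>n. geometric_energy m \<nu> (A n) F lam)"
      by (intro lsc LIMSEQ_indicator_decseq) auto
  qed
qed

lemma emeasure_less_top: "emeasure \<nu> A < top"
  by (metis emeasure_finite infinity_ennreal_def top.not_eq_extremum)

lemma indicator_in_L1:
  assumes "A \<in> sets (completion \<nu>)"
  shows "indicat_real A \<in> L1 \<nu>"
  unfolding L1_def mem_Collect_eq
  by (rule integrable_real_indicator[OF assms])
    (simp only: emeasure_completion[OF assms] infinity_ennreal_def emeasure_less_top)

lemma INF_geometric_energy_le_energy:
  assumes lam: "0 \<le> lam" and F: "F \<in> sets (completion \<nu>)" and u: "u \<in> L1 \<nu>"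
  shows "(INF B\<in>sets borel. geometric_energy m \<nu> B F lam) \<le> energy m \<nu> u (indicat_real F) lam"
    (is "?I \<le> _")
proof -
  have "?I = (\<integral>\<^sup>+t\<in>{0<..<1::real}. ?I \<partial>lborel)"
    by (rule nn_integral_unit_interval_const[symmetric])
  also have "\<dots> \<le> (\<integral>\<^sup>+t\<in>{0<..<1}. geometric_energy m \<nu> (superlevel u t) F lam \<partial>lborel)"
    by (intro nn_integral_mono mult_right_mono INF_le_geometric_energy_superlevel[OF assms]) simp
  also have "\<dots> \<le> energy m \<nu> u (indicat_real F) lam"
    by (rule geometric_energy_coarea_le[OF assms])
  finally show ?thesis .
qed

text \<open>
  The geometric energies of the superlevel sets are all at least the infimum, while their integral
  over the unit interval of levels is at most the infimum; hence they equal it for almost every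
  level. The finiteness of the infimum makes the subtraction legitimate.
\<close>

lemma superlevel_geometric_minimizer:
  assumes lam: "0 \<le> lam" and F: "F \<in> sets (completion \<nu>)" and u: "u \<in> L1 \<nu>"
    and finite: "(INF B\<in>sets borel. geometric_energy m \<nu> B F lam) < \<infinity>"
    and le: "energy m \<nu> u (indicat_real F) lam \<le> (INF B\<in>sets borel. geometric_energy m \<nu> B F lam)"
      (is "_ \<le> ?I")
  shows "AE t in lborel. 0 < t \<and> t < 1 \<longrightarrow> geometric_minimizer m \<nu> F lam (superlevel u t)"
proof -
  define J where "J t = geometric_energy m \<nu> (superlevel u t) F lam" for t
  have [measurable]: "J \<in> borel_measurable lborel"
    unfolding J_def by (rule geometric_energy_superlevel_measurable[OF lam F u])
  have J_ge: "?I \<le> J t" for t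
    unfolding J_def by (rule INF_le_geometric_energy_superlevel[OF lam F u])
  have J_le: "(\<integral>\<^sup>+t\<in>{0<..<1}. J t \<partial>lborel) \<le> energy m \<nu> u (indicat_real F) lam"
    unfolding J_def by (rule geometric_energy_coarea_le[OF lam F u])
  have int_I: "(\<integral>\<^sup>+t\<in>{0<..<1::real}. ?I \<partial>lborel) = ?I"
    by (rule nn_integral_unit_interval_const)
  have "(\<integral>\<^sup>+t. J t * indicator {0<..<1} t - ?I * indicator {0<..<1} t \<partial>lborel) =
      (\<integral>\<^sup>+t\<in>{0<..<1}. J t \<partial>lborel) - (\<integral>\<^sup>+t\<in>{0<..<1::real}. ?I \<partial>lborel)"
  proof (rule nn_integral_diff)
    show "(\<integral>\<^sup>+t\<in>{0<..<1::real}. ?I \<partial>lborel) \<noteq> \<infinity>"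
      unfolding int_I by (rule less_imp_neq[OF finite])
    show "AE t in lborel. ?I * indicator {0<..<1} t \<le> J t * indicator {0<..<1} t"
      by (intro AE_I2 mult_right_mono J_ge) simp
  qed measurable
  also have "\<dots> = 0"
    unfolding int_I using order_trans[OF J_le le] finite
    by (intro diff_eq_0_ennreal) (simp_all only: infinity_ennreal_def le_less_trans)
  finally have "AE t in lborel. J t * indicator {0<..<1} t - ?I * indicator {0<..<1} t = 0"
    by (subst (asm) nn_integral_0_iff_AE) auto
  then show ?thesis
  proof eventually_elim
    case (elim t)
    show ?case
    proof
      assume "0 < t \<and> t < 1"
      then have "J t - ?I = 0" using elim by simp
      then have "J t \<le> ?I" by (simp add: diff_eq_0_iff_ennreal finite)
      then show "geometric_minimizer m \<nu> F lam (superlevel u t)"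
        unfolding geometric_minimizer_def
        using J_ge[of t] superlevel_sets_completion[OF lam F u] by (simp add: J_def antisym)
    qed
  qed
qed

lemma INF_geometric_energy_finite:
  assumes F: "F \<in> sets (completion \<nu>)"
  shows "(INF B\<in>sets borel. geometric_energy m \<nu> B F lam) < \<infinity>"
proof -
  have "geometric_energy m \<nu> {} F lam = ennreal lam * emeasure \<nu> (main_part \<nu> F)"
    using F by (simp add: geometric_energy_def perimeter_def)
  also have "\<dots> < \<infinity>"
    using emeasure_less_top by (simp add: ennreal_mult_less_top)
  finally have "geometric_energy m \<nu> {} F lam < \<infinity>" .
  moreover have "(INF B\<in>sets borel. geometric_energy m \<nu> B F lam) \<le> geometric_energy m \<nu> {} F lam"
    by (rule INF_lower) (rule sets.empty_sets)
  ultimately show ?thesis by (rule le_less_trans[rotated])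
qed

end

theorem theorem3p9:
  fixes m :: "'a::polish_space \<Rightarrow> 'a measure"
    and \<nu> :: "'a measure"
    and F :: "'a set"
    and lam :: real
  assumes "random_walk m"
    and "finite_radon_measure \<nu>"
    and "emeasure \<nu> UNIV > 0"
    and "reversible m \<nu>"
    and "ergodic m \<nu>"
    and "F \<in> sets (completion \<nu>)"
    and "emeasure (completion \<nu>) F > 0"
    and "lam > 0"
  shows "(\<exists>u. energy_minimizer m \<nu> (indicat_real F) lam u) \<and>
    (\<forall>u. energy_minimizer m \<nu> (indicat_real F) lam u \<longrightarrow>
       (AE t in lborel. 0 < t \<and> t < 1 \<longrightarrow> geometric_minimizer m \<nu> F lam (superlevel u t))) \<and>
    (\<exists>A\<in>sets borel. geometric_minimizer m \<nu> F lam A) \<and>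
    (INF A\<in>sets borel. geometric_energy m \<nu> A F lam) =
      (INF u\<in>L1 \<nu>. energy m \<nu> u (indicat_real F) lam)"
proof -
  interpret reversible_walk m \<nu>
    using assms(1,2,4) by (simp add: reversible_walk_def finite_radon_measure_def)
  note lam = less_imp_le[OF \<open>lam > 0\<close>] and F = \<open>F \<in> sets (completion \<nu>)\<close>
  let ?f = "indicat_real F"
  let ?I = "INF B\<in>sets borel. geometric_energy m \<nu> B F lam"
  obtain A where A: "A \<in> sets borel" "geometric_energy m \<nu> A F lam = ?I"
    using geometric_energy_attains_INF[OF lam F] by blast
  note A_compl = sets_completion_borel[OF A(1)]
  have A_energy: "energy m \<nu> (indicat_real A) ?f lam = ?I"
    using A(2) unfolding geometric_energy_eq_energy[OF A_compl F] .
  have A_L1: "indicat_real A \<in> L1 \<nu>"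
    by (rule indicator_in_L1[OF A_compl])
  have INF_eq: "?I = (INF u\<in>L1 \<nu>. energy m \<nu> u ?f lam)"
  proof (rule antisym)
    show "?I \<le> (INF u\<in>L1 \<nu>. energy m \<nu> u ?f lam)"
      by (intro INF_greatest INF_geometric_energy_le_energy[OF lam F])
    show "(INF u\<in>L1 \<nu>. energy m \<nu> u ?f lam) \<le> ?I"
      unfolding A_energy[symmetric] by (rule INF_lower[OF A_L1])
  qed
  have "energy_minimizer m \<nu> ?f lam (indicat_real A)"
    unfolding energy_minimizer_def INF_eq[symmetric] by (intro conjI A_L1 A_energy)
  moreover have "AE t in lborel. 0 < t \<and> t < 1 \<longrightarrow> geometric_minimizer m \<nu> F lam (superlevel u t)"
    if "energy_minimizer m \<nu> ?f lam u" for u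
  proof (rule superlevel_geometric_minimizer[OF lam F _ INF_geometric_energy_finite[OF F]])
    show "u \<in> L1 \<nu>" "energy m \<nu> u ?f lam \<le> ?I"
      using that unfolding energy_minimizer_def INF_eq[symmetric] by (blast intro: eq_refl)+
  qed
  moreover have "geometric_minimizer m \<nu> F lam A"
    unfolding geometric_minimizer_def by (intro conjI A_compl A(2))
  ultimately show ?thesis
    using A(1) INF_eq by (intro conjI exI allI impI bexI)
qed

end
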